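(* Let $(A,* )$ be a right alternative superalgebra. Then its supercommutator superalgebra is a Bol superalgebra; precisely, with $$[x,y]:=\tfrac12\big(x*y-(-1)^{\bar x\bar y}y*x\big),\qquad \{x,y,z\}:=(-1)^{\bar x(\bar y+\bar z)}\big((y\circ z)\circ x-y\circ(z\circ x)\big)$$ for homogeneous $x,y,z\in A$, where $x\circ y:=\tfrac12\big(x*y+(-1)^{\bar x\bar y}y*x\big)$, the triple $(A,[\cdot,\cdot],\{\cdot,\cdot,\cdot\})$ is a Bol superalgebra.
   Context: All vector spaces are over a fixed field of characteristic not $2$ or $3$. A superspace is a $\mathbb Z_2$-graded vector space $A=A_0\oplus A_1$; $\bar x$ is the degree of a homogeneous $x$. A (binary) superalgebra $(A,* )$ is a superspace with a bilinear product such that $A_i*A_j\subseteq A_{i+j}$. It is right alternative if $as(x,y,z)=-(-1)^{\bar y\bar z}as(x,z,y)$ for all homogeneous $x,y,z$, where $as(x,y,z)=(x*y)*z-x*(y*z)$. A Bol superalgebra is a triple $(A,[\cdot,\cdot],\{\cdot,\cdot,\cdot\})$ with $A$ a superspace, $[\cdot,\cdot]$ bilinear and $\{\cdot,\cdot,\cdot\}$ trilinear, such that for all homogeneous $u,v,w,x,y,z\in A$: (SB01) $[A_i,A_j]\subseteq A_{i+j}$; (SB02) $\{A_i,A_j,A_k\}\subseteq A_{i+j+k}$; (SB1) $[x,y]=-(-1)^{\bar x\bar y}[y,x]$; (SB2) $\{x,y,z\}=-(-1)^{\bar x\bar y}\{y,x,z\}$; (SB3) $\{x,y,z\}+(-1)^{\bar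 x(\bar y+\bar z)}\{y,z,x\}+(-1)^{\bar z(\bar x+\bar y)}\{z,x,y\}=0$; (SB4) $\{x,y,[u,v]\}=[\{x,y,u\},v]+(-1)^{\bar u(\bar x+\bar y)}[u,\{x,y,v\}]+(-1)^{(\bar x+\bar y)(\bar u+\bar v)}\big(\{u,v,[x,y]\}-[[u,v],[x,y]]\big)$; (SB5) $\{x,y,\{u,v,w\}\}=\{\{x,y,u\},v,w\}+(-1)^{\bar u(\bar x+\bar y)}\{u,\{x,y,v\},w\}+(-1)^{(\bar x+\bar y)(\bar u+\bar v)}\{u,v,\{x,y,w\}\}$. *)

theory Defs
  imports Complex_Main "HOL-Library.Z2"
begin

section \<open>Superspaces\<close>

text \<open>
  Degrees live in the two-element field \<^typ>\<open>bit\<close>, so sums and products of degrees are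
  those of the integers modulo 2. For a degree expression \<open>d\<close>, \<open>psign d x\<close> is
  \<open>(-1)\<close> to the power \<open>d\<close>, times \<open>x\<close>.
\<close>

definition psign :: "bit \<Rightarrow> 'a::ab_group_add \<Rightarrow> 'a" where
  "psign d x = (if d = 0 then x else - x)"

text \<open>
  The whole type \<open>'a\<close> is the vector space, and \<open>A i\<close> is its homogeneous part of degree \<open>i\<close>.
  The zero vector is homogeneous of both degrees, so identities are stated for
  vectors together with degrees \<open>i\<close> such that \<open>x \<in> A i\<close>, not by a degree function.
\<close>

locale superspace = vector_space scale
  for scale :: "'k::field \<Rightarrow> 'a::ab_group_add \<Rightarrow> 'a" +
  fixes A :: "bit \<Rightarrow> 'a set"
  assumes subspace_part: "subspace (A i)"
    and parts_disjoint: "A 0 \<inter> A 1 = {0}"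
    and parts_span: "\<exists>y \<in> A 0. \<exists>z \<in> A 1. x = y + z"

definition bilinear_map ::
  "('k::field \<Rightarrow> 'a::ab_group_add \<Rightarrow> 'a) \<Rightarrow> ('a \<Rightarrow> 'a \<Rightarrow> 'a) \<Rightarrow> bool" where
  "bilinear_map scale f \<longleftrightarrow>
     (\<forall>y. Vector_Spaces.linear scale scale (\<lambda>x. f x y)) \<and>
     (\<forall>x. Vector_Spaces.linear scale scale (\<lambda>y. f x y))"

definition trilinear_map ::
  "('k::field \<Rightarrow> 'a::ab_group_add \<Rightarrow> 'a) \<Rightarrow> ('a \<Rightarrow> 'a \<Rightarrow> 'a \<Rightarrow> 'a) \<Rightarrow> bool" where
  "trilinear_map scale f \<longleftrightarrow>
     (\<forall>y z. Vector_Spaces.linear scale scale (\<lambda>x. f x y z)) \<and>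
     (\<forall>x z. Vector_Spaces.linear scale scale (\<lambda>y. f x y z)) \<and>
     (\<forall>x y. Vector_Spaces.linear scale scale (\<lambda>z. f x y z))"

definition associator :: "('a::ab_group_add \<Rightarrow> 'a \<Rightarrow> 'a) \<Rightarrow> 'a \<Rightarrow> 'a \<Rightarrow> 'a \<Rightarrow> 'a" where
  "associator m x y z = m (m x y) z - m x (m y z)"


section \<open>Superalgebras\<close>

locale superalgebra = superspace scale A
  for scale :: "'k::field \<Rightarrow> 'a::ab_group_add \<Rightarrow> 'a" and A :: "bit \<Rightarrow> 'a set" +
  fixes m :: "'a \<Rightarrow> 'a \<Rightarrow> 'a"
  assumes mult_bilinear: "bilinear_map scale m"
    and mult_graded: "x \<in> A i \<Longrightarrow> y \<in> A j \<Longrightarrow> m x y \<in> A (i + j)"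

locale right_alternative_superalgebra = superalgebra scale A m
  for scale :: "'k::field \<Rightarrow> 'a::ab_group_add \<Rightarrow> 'a" and A :: "bit \<Rightarrow> 'a set"
    and m :: "'a \<Rightarrow> 'a \<Rightarrow> 'a" +
  assumes right_alternative:
    "x \<in> A i \<Longrightarrow> y \<in> A j \<Longrightarrow> z \<in> A k \<Longrightarrow>
       associator m x y z = - psign (j * k) (associator m x z y)"

locale bol_superalgebra = superspace scale A
  for scale :: "'k::field \<Rightarrow> 'a::ab_group_add \<Rightarrow> 'a" and A :: "bit \<Rightarrow> 'a set" +
  fixes br :: "'a \<Rightarrow> 'a \<Rightarrow> 'a" and tr :: "'a \<Rightarrow> 'a \<Rightarrow> 'a \<Rightarrow> 'a"
  assumes br_bilinear: "bilinear_map scale br"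
    and tr_trilinear: "trilinear_map scale tr"
    and SB01: "x \<in> A i \<Longrightarrow> y \<in> A j \<Longrightarrow> br x y \<in> A (i + j)"
    and SB02: "x \<in> A i \<Longrightarrow> y \<in> A j \<Longrightarrow> z \<in> A k \<Longrightarrow> tr x y z \<in> A (i + j + k)"
    and SB1: "x \<in> A i \<Longrightarrow> y \<in> A j \<Longrightarrow> br x y = - psign (i * j) (br y x)"
    and SB2: "x \<in> A i \<Longrightarrow> y \<in> A j \<Longrightarrow> z \<in> A k \<Longrightarrow>
      tr x y z = - psign (i * j) (tr y x z)"
    and SB3: "x \<in> A i \<Longrightarrow> y \<in> A j \<Longrightarrow> z \<in> A k \<Longrightarrow>
      tr x y z + psign (i * (j + k)) (tr y z x) + psign (k * (i + j)) (tr z x y) = 0"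
    and SB4: "x \<in> A i \<Longrightarrow> y \<in> A j \<Longrightarrow> u \<in> A p \<Longrightarrow> v \<in> A q \<Longrightarrow>
      tr x y (br u v) =
        br (tr x y u) v
        + psign (p * (i + j)) (br u (tr x y v))
        + psign ((i + j) * (p + q)) (tr u v (br x y) - br (br u v) (br x y))"
    and SB5: "x \<in> A i \<Longrightarrow> y \<in> A j \<Longrightarrow> u \<in> A p \<Longrightarrow> v \<in> A q \<Longrightarrow> w \<in> A r \<Longrightarrow>
      tr x y (tr u v w) =
        tr (tr x y u) v w
        + psign (p * (i + j)) (tr u (tr x y v) w)
        + psign ((i + j) * (p + q)) (tr u v (tr x y w))"


section \<open>Operations given on homogeneous elements\<close>

text \<open>
  A formula \<open>f i j x y\<close> prescribed for \<open>x\<close> of degree \<open>i\<close> and \<open>y\<close> of degree \<open>j\<close> is extended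
  to all vectors by summing over their homogeneous components, and similarly for three
  arguments.
\<close>

definition component :: "(bit \<Rightarrow> 'a::ab_group_add set) \<Rightarrow> bit \<Rightarrow> 'a \<Rightarrow> 'a" where
  "component A i x = (THE y. y \<in> A i \<and> x - y \<in> A (i + 1))"

definition extend2 ::
  "(bit \<Rightarrow> 'a::ab_group_add set) \<Rightarrow> (bit \<Rightarrow> bit \<Rightarrow> 'a \<Rightarrow> 'a \<Rightarrow> 'a) \<Rightarrow> 'a \<Rightarrow> 'a \<Rightarrow> 'a" where
  "extend2 A f x y =
     (\<Sum>i\<in>{0, 1}. \<Sum>j\<in>{0, 1}. f i j (component A i x) (component A j y))"

definition extend3 ::
  "(bit \<Rightarrow> 'a::ab_group_add set) \<Rightarrow> (bit \<Rightarrow> bit \<Rightarrow> bit \<Rightarrow> 'a \<Rightarrow> 'a \<Rightarrow> 'a \<Rightarrow> 'a)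
     \<Rightarrow> 'a \<Rightarrow> 'a \<Rightarrow> 'a \<Rightarrow> 'a" where
  "extend3 A f x y z =
     (\<Sum>i\<in>{0, 1}. \<Sum>j\<in>{0, 1}. \<Sum>k\<in>{0, 1}.
        f i j k (component A i x) (component A j y) (component A k z))"

definition supercommutator ::
  "('k::field \<Rightarrow> 'a::ab_group_add \<Rightarrow> 'a) \<Rightarrow> (bit \<Rightarrow> 'a set) \<Rightarrow> ('a \<Rightarrow> 'a \<Rightarrow> 'a)
     \<Rightarrow> 'a \<Rightarrow> 'a \<Rightarrow> 'a" where
  "supercommutator scale A m =
     extend2 A (\<lambda>i j x y. scale (1 / 2) (m x y - psign (i * j) (m y x)))"

definition supercircle ::
  "('k::field \<Rightarrow> 'a::ab_group_add \<Rightarrow> 'a) \<Rightarrow> (bit \<Rightarrow> 'a set) \<Rightarrow> ('a \<Rightarrow> 'a \<Rightarrow> 'a)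
     \<Rightarrow> 'a \<Rightarrow> 'a \<Rightarrow> 'a" where
  "supercircle scale A m =
     extend2 A (\<lambda>i j x y. scale (1 / 2) (m x y + psign (i * j) (m y x)))"

definition supertriple ::
  "('k::field \<Rightarrow> 'a::ab_group_add \<Rightarrow> 'a) \<Rightarrow> (bit \<Rightarrow> 'a set) \<Rightarrow> ('a \<Rightarrow> 'a \<Rightarrow> 'a)
     \<Rightarrow> 'a \<Rightarrow> 'a \<Rightarrow> 'a \<Rightarrow> 'a" where
  "supertriple scale A m =
     (let c = supercircle scale A m in
      extend3 A (\<lambda>i j k x y z. psign (i * (j + k)) (c (c y z) x - c y (c z x))))"


text \<open>On homogeneous elements the extended operations are given by the prescribed formulas.\<close>

context superspace
begin

lemma zero_in_part: "0 \<in> A i"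
  using subspace_part by (rule subspace_0)

lemma component_homogeneous:
  assumes "x \<in> A i"
  shows "component A k x = (if k = i then x else 0)"
proof -
  have unique: "y = y'"
    if y: "y \<in> A k" "x - y \<in> A (k + 1)" "y' \<in> A k" "x - y' \<in> A (k + 1)" for y y'
  proof -
    have "y - y' \<in> A k"
      using y subspace_part subspace_diff by blast
    moreover have "(x - y') - (x - y) \<in> A (k + 1)"
      using y subspace_part subspace_diff by blast
    hence "y - y' \<in> A (k + 1)" by simp
    ultimately have "y - y' \<in> A 0 \<inter> A 1"
      by (cases k) auto
    thus ?thesis using parts_disjoint by simp
  qed
  have ex: "(if k = i then x else 0) \<in> A k \<and> x - (if k = i then x else 0) \<in> A (k + 1)"
    using assms zero_in_part by (cases k; cases i) auto
  show ?thesis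
    unfolding component_def using ex unique by (intro the_equality) blast+
qed

lemma component_zero [simp]: "component A k 0 = 0"
  using component_homogeneous[OF zero_in_part, of k k] by simp

lemma extend2_homogeneous:
  assumes "x \<in> A i" "y \<in> A j"
    and "\<And>i j y. f i j 0 y = 0" "\<And>i j x. f i j x 0 = 0"
  shows "extend2 A f x y = f i j x y"
  using assms(3,4)
  by (cases i; cases j)
     (simp_all add: extend2_def component_homogeneous[OF assms(1)]
        component_homogeneous[OF assms(2)])

lemma extend3_homogeneous:
  assumes "x \<in> A i" "y \<in> A j" "z \<in> A k"
    and "\<And>i j k y z. f i j k 0 y z = 0" "\<And>i j k x z. f i j k x 0 z = 0"
      "\<And>i j k x y. f i j k x y 0 = 0"
  shows "extend3 A f x y z = f i j k x y z"
  using assms(4-6)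
  by (cases i; cases j; cases k)
     (simp_all add: extend3_def component_homogeneous[OF assms(1)]
        component_homogeneous[OF assms(2)] component_homogeneous[OF assms(3)])

end

context superalgebra
begin

lemma mult_zero [simp]: "m 0 y = 0" "m x 0 = 0"
proof -
  interpret l: Vector_Spaces.linear scale scale "\<lambda>x. m x y"
    using mult_bilinear by (simp add: bilinear_map_def)
  interpret r: Vector_Spaces.linear scale scale "\<lambda>y. m x y"
    using mult_bilinear by (simp add: bilinear_map_def)
  show "m 0 y = 0" "m x 0 = 0"
    using l.zero r.zero by simp_all
qed

lemma supercommutator_homogeneous:
  "x \<in> A i \<Longrightarrow> y \<in> A j \<Longrightarrow>
     supercommutator scale A m x y = scale (1 / 2) (m x y - psign (i * j) (m y x))"
  unfolding supercommutator_def by (rule extend2_homogeneous) (simp_all add: psign_def)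

lemma supercircle_homogeneous:
  "x \<in> A i \<Longrightarrow> y \<in> A j \<Longrightarrow>
     supercircle scale A m x y = scale (1 / 2) (m x y + psign (i * j) (m y x))"
  unfolding supercircle_def by (rule extend2_homogeneous) (simp_all add: psign_def)

lemma supercircle_zero [simp]: "supercircle scale A m 0 y = 0" "supercircle scale A m x 0 = 0"
  by (simp_all add: supercircle_def extend2_def psign_def)

lemma supertriple_homogeneous:
  "x \<in> A i \<Longrightarrow> y \<in> A j \<Longrightarrow> z \<in> A k \<Longrightarrow>
     supertriple scale A m x y z =
       psign (i * (j + k))
         (supercircle scale A m (supercircle scale A m y z) x
          - supercircle scale A m y (supercircle scale A m z x))"
  unfolding supertriple_def Let_def by (rule extend3_homogeneous) (simp_all add: psign_def)

end

end

theory Submission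
  imports Defs
begin

text \<open>
  Let \<open>R\<^sub>x\<close> be right multiplication by \<open>x\<close>. Right alternativity says that \<open>x \<mapsto> R\<^sub>x\<close> turns the
  circle product into the supersymmetrized composition of operators. Hence
  \<open>4 {x,y,z}\<close> is the super-commutator \<open>[[x,y],z]\<close> expanded into left-normed words, and
  \<open>4 R\<close> of \<open>{x,y,z}\<close> is \<open>[[R\<^sub>x,R\<^sub>y],R\<^sub>z]\<close>. With these two formulas each Bol identity turns into an
  identity between left-normed words, which holds in the free associative superalgebra; in (SB4)
  the words ending in \<open>[u,v]\<close> or \<open>[x,y]\<close> cancel separately.
\<close>

lemma (in superspace) psign_in_part: "x \<in> A i \<Longrightarrow> psign d x \<in> A i"
  using subspace_neg[OF subspace_part] by (simp add: psign_def)

lemma (in superspace) component_eqI: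
  assumes "y \<in> A k" "x - y \<in> A (k + 1)"
  shows "component A k x = y"
  unfolding component_def
proof (rule the_equality)
  fix y' assume y': "y' \<in> A k \<and> x - y' \<in> A (k + 1)"
  have "y' - y \<in> A k" "(x - y) - (x - y') \<in> A (k + 1)"
    using assms y' subspace_part subspace_diff by blast+
  hence "y' - y \<in> A 0 \<inter> A 1" by (cases k) auto
  thus "y' = y" using parts_disjoint by simp
qed (use assms in simp)

text \<open>\<open>component\<close> is a definite description, so facts about it need existence and
  uniqueness: \<open>parts_span\<close> gives the first, \<open>component_eqI\<close> the
  second.\<close>

lemma (in superspace) component_in_part:
  "component A k x \<in> A k" "x - component A k x \<in> A (k + 1)"
proof -
  obtain y z where "y \<in> A 0" "z \<in> A 1" "x = y + z" using parts_span by blast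
  hence "\<exists>w \<in> A k. x - w \<in> A (k + 1)"
    by (cases k) (auto intro: bexI[of _ y] bexI[of _ z])
  thus "component A k x \<in> A k" "x - component A k x \<in> A (k + 1)"
    using component_eqI by auto
qed

lemma (in superspace) component_add:
  "component A k (x + y) = component A k x + component A k y"
proof (rule component_eqI)
  have "(x - component A k x) + (y - component A k y) \<in> A (k + 1)"
    by (intro subspace_add subspace_part component_in_part)
  thus "x + y - (component A k x + component A k y) \<in> A (k + 1)"
    by (simp add: algebra_simps)
qed (intro subspace_add subspace_part component_in_part)

lemma (in superspace) component_scale:
  "component A k (scale c x) = scale c (component A k x)"
proof (rule component_eqI)
  have "scale c (x - component A k x) \<in> A (k + 1)"
    by (intro subspace_scale subspace_part component_in_part)
  thus "scale c x - scale c (component A k x) \<in> A (k + 1)"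
    by (simp add: scale_right_diff_distrib)
qed (intro subspace_scale subspace_part component_in_part)

text \<open>\<open>Vector_Spaces.linear\<close> also carries the vector space axioms. The locale
  supplies them, and plain equations for the simplifier remain.\<close>

lemma (in vector_space) bilinear_map_iff:
  "bilinear_map scale f \<longleftrightarrow>
     (\<forall>x x' y. f (x + x') y = f x y + f x' y) \<and> (\<forall>c x y. f (scale c x) y = scale c (f x y)) \<and>
     (\<forall>x y y'. f x (y + y') = f x y + f x y') \<and> (\<forall>c x y. f x (scale c y) = scale c (f x y))"
  unfolding bilinear_map_def Vector_Spaces.linear_iff using vector_space_axioms by blast

lemma (in vector_space) trilinear_map_iff:
  "trilinear_map scale f \<longleftrightarrow>
     (\<forall>x x' y z. f (x + x') y z = f x y z + f x' y z) \<and>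
     (\<forall>c x y z. f (scale c x) y z = scale c (f x y z)) \<and>
     (\<forall>x y y' z. f x (y + y') z = f x y z + f x y' z) \<and>
     (\<forall>c x y z. f x (scale c y) z = scale c (f x y z)) \<and>
     (\<forall>x y z z'. f x y (z + z') = f x y z + f x y z') \<and>
     (\<forall>c x y z. f x y (scale c z) = scale c (f x y z))"
  unfolding trilinear_map_def Vector_Spaces.linear_iff
  by (auto simp: vector_space_axioms)

text \<open>Taking components is linear, so a finite sum of bilinear maps of components stays
  bilinear.\<close>

lemma (in superspace) bilinear_map_extend2:
  assumes "\<And>i j. bilinear_map scale (f i j)"
  shows "bilinear_map scale (extend2 A f)"
  using assms unfolding bilinear_map_iff extend2_def component_add component_scale
  by (simp add: scale_right_distrib add_ac)

lemma (in superspace) trilinear_map_extend3: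
  assumes "\<And>i j k. trilinear_map scale (f i j k)"
  shows "trilinear_map scale (extend3 A f)"
  using assms unfolding trilinear_map_iff extend3_def component_add component_scale
  by (simp add: scale_right_distrib add_ac)

context superalgebra
begin

lemma mult_linear:
  "m (x + y) z = m x z + m y z" "m x (y + z) = m x y + m x z"
  "m (scale c x) y = scale c (m x y)" "m x (scale c y) = scale c (m x y)"
  using mult_bilinear unfolding bilinear_map_iff by simp_all

lemma mult_minus: "m (- x) y = - m x y" "m x (- y) = - m x y"
  using mult_linear(1)[of x "- x" y] mult_linear(2)[of x y "- y"]
  by (simp_all add: eq_neg_iff_add_eq_0 add.commute)

lemma mult_diff: "m (x - y) z = m x z - m y z" "m x (y - z) = m x y - m x z"
  using mult_linear(1)[of x "- y" z] mult_linear(2)[of x y "- z"] by (simp_all add: mult_minus)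

lemmas mult_expand = mult_linear mult_minus mult_diff
  scale_right_distrib scale_right_diff_distrib

lemma bilinear_supercommutator: "bilinear_map scale (supercommutator scale A m)"
  unfolding supercommutator_def
  by (intro bilinear_map_extend2)
     (simp add: bilinear_map_iff psign_def mult_expand scale_left_commute algebra_simps)

lemma bilinear_supercircle: "bilinear_map scale (supercircle scale A m)"
  unfolding supercircle_def
  by (intro bilinear_map_extend2)
     (simp add: bilinear_map_iff psign_def mult_expand scale_left_commute algebra_simps)

lemma trilinear_supertriple: "trilinear_map scale (supertriple scale A m)"
  unfolding supertriple_def Let_def
proof (rule trilinear_map_extend3)
  fix i j k :: bit
  let ?c = "supercircle scale A m"
  show "trilinear_map scale (\<lambda>x y z. psign (i * (j + k)) (?c (?c y z) x - ?c y (?c z x)))"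
    using bilinear_supercircle unfolding bilinear_map_iff trilinear_map_iff
    by (cases "i * (j + k)")
      (simp_all only: psign_def, simp_all add: scale_right_diff_distrib algebra_simps)
qed

lemma supercommutator_graded:
  "x \<in> A i \<Longrightarrow> y \<in> A j \<Longrightarrow> supercommutator scale A m x y \<in> A (i + j)"
  using mult_graded[of x i y j] mult_graded[of y j x i]
  by (cases i; cases j; simp add: supercommutator_homogeneous
        subspace_scale subspace_diff subspace_part psign_in_part)

lemma supercircle_graded:
  "x \<in> A i \<Longrightarrow> y \<in> A j \<Longrightarrow> supercircle scale A m x y \<in> A (i + j)"
  using mult_graded[of x i y j] mult_graded[of y j x i]
  by (cases i; cases j; simp add: supercircle_homogeneous
        subspace_scale subspace_add subspace_part psign_in_part)

lemma supertriple_graded: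
  assumes "x \<in> A i" "y \<in> A j" "z \<in> A k"
  shows "supertriple scale A m x y z \<in> A (i + j + k)"
proof -
  have "supercircle scale A m (supercircle scale A m y z) x \<in> A ((j + k) + i)"
    "supercircle scale A m y (supercircle scale A m z x) \<in> A (j + (k + i))"
    by (intro supercircle_graded assms)+
  thus ?thesis
    unfolding supertriple_homogeneous[OF assms]
    by (intro psign_in_part) (simp only: subspace_diff subspace_part ac_simps)
qed

end

context right_alternative_superalgebra
begin

text \<open>By right alternativity \<open>associator m a x y\<close> and the signed
  \<open>associator m a y x\<close> add up to zero. The subtracted terms \<open>m a (m x y)\<close>
  and \<open>m a (m y x)\<close> combine into the circle product.\<close>

lemma mult_supercircle:
  assumes "a \<in> A l" "x \<in> A i" "y \<in> A j"
  shows "m a (supercircle scale A m x y) = scale (1 / 2) (m (m a x) y + psign (i * j) (m (m a y) x))"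
proof -
  have "m a (m x y + psign (i * j) (m y x)) = m (m a x) y + psign (i * j) (m (m a y) x)"
    using right_alternative[OF assms]
    by (cases "i * j") (simp_all add: associator_def psign_def mult_expand algebra_simps)
  thus ?thesis
    by (simp add: supercircle_homogeneous[OF assms(2,3)] mult_linear)
qed

text \<open>Opening the outer and then the inner circles gives eight words. Those with
  \<open>z\<close> in the middle come from both summands of the triple product and cancel. Each
  level of circles contributes one half.\<close>

lemma mult_supertriple:
  assumes "a \<in> A l" "x \<in> A i" "y \<in> A j" "z \<in> A k"
  shows "m a (supertriple scale A m x y z) = scale (1 / 2) (scale (1 / 2)
    (m (m (m a x) y) z - psign (i * j) (m (m (m a y) x) z)
     - psign (k * (i + j)) (m (m (m a z) x) y - psign (i * j) (m (m (m a z) y) x))))"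
  unfolding supertriple_homogeneous[OF assms(2-4)]
  using mult_supercircle[OF assms(1) supercircle_graded[OF assms(3,4)] assms(2)]
    mult_supercircle[OF assms(1,3) supercircle_graded[OF assms(4,2)]]
    mult_supercircle[OF assms(1,3,4)] mult_supercircle[OF assms(1,4,2)]
    mult_supercircle[OF mult_graded[OF assms(1,2)] assms(3,4)]
    mult_supercircle[OF mult_graded[OF assms(1,3)] assms(4,2)]
  by (cases i; cases j; cases k) (simp_all add: psign_def mult_expand)

text \<open>As \<open>m\<close> need not have a unit, this is no special case of
  \<open>mult_supertriple\<close>. An inner circle is opened by definition where it is a left
  factor, and by \<open>mult_supercircle\<close> where it is a right factor.\<close>

lemma supertriple_words:
  assumes "x \<in> A i" "y \<in> A j" "z \<in> A k"
  shows "supertriple scale A m x y z = scale (1 / 2) (scale (1 / 2)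
    (m (m x y) z - psign (i * j) (m (m y x) z)
     - psign (k * (i + j)) (m (m z x) y - psign (i * j) (m (m z y) x))))"
  unfolding supertriple_homogeneous[OF assms]
    supercircle_homogeneous[OF supercircle_graded[OF assms(2,3)] assms(1)]
    supercircle_homogeneous[OF assms(2) supercircle_graded[OF assms(3,1)]]
  unfolding mult_supercircle[OF assms] mult_supercircle[OF assms(2,3,1)]
  unfolding supercircle_homogeneous[OF assms(2,3)] supercircle_homogeneous[OF assms(3,1)]
  by (cases i; cases j; cases k) (simp_all add: psign_def mult_expand algebra_simps)

text \<open>For associative \<open>m\<close> the last summand vanishes, and the rest is the
  derivation rule for supercommutation with \<open>br x y\<close>. In general that summand corrects
  for \<open>m (br x y) (br u v)\<close> not expanding into left-normed words.\<close>

lemma supertriple_supercommutator: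
  assumes "x \<in> A i" "y \<in> A j" "u \<in> A p" "v \<in> A q"
  defines "br \<equiv> supercommutator scale A m" and "tr \<equiv> supertriple scale A m"
  shows "tr x y (br u v) =
        br (tr x y u) v
        + psign (p * (i + j)) (br u (tr x y v))
        + psign ((i + j) * (p + q)) (tr u v (br x y) - br (br u v) (br x y))"
proof -
  note br = supercommutator_homogeneous
  note outer =
    supertriple_words[OF assms(1,2) supercommutator_graded[OF assms(3,4)]]
    supertriple_words[OF assms(3,4) supercommutator_graded[OF assms(1,2)]]
    br[OF supertriple_graded[OF assms(1,2,3)] assms(4)]
    br[OF assms(3) supertriple_graded[OF assms(1,2,4)]]
    br[OF supercommutator_graded[OF assms(3,4)] supercommutator_graded[OF assms(1,2)]]
  note right = mult_supertriple[OF assms(4,1,2,3)] mult_supertriple[OF assms(3,1,2,4)]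
  note inner = supertriple_words[OF assms(1,2,3)] supertriple_words[OF assms(1,2,4)]
  \<comment> \<open>Right alternativity gives no expansion of right multiplication by a
    supercommutator. It is therefore opened only as a left factor and stays an atom as a right
    factor.\<close>
  have C: "m (br x y) w = scale (1/2) (m (m x y) w - psign (i * j) (m (m y x) w))" for w
    unfolding br_def br[OF assms(1,2)] by (simp add: psign_def mult_expand)
  have B: "m (br u v) w = scale (1/2) (m (m u v) w - psign (p * q) (m (m v u) w))" for w
    unfolding br_def br[OF assms(3,4)] by (simp add: psign_def mult_expand)
  show ?thesis
    \<comment> \<open>The order matters: \<open>right\<close> must treat triple products in right
      position before \<open>inner\<close> rewrites all that remain.\<close>
    unfolding tr_def br_def outer unfolding right unfolding inner B[unfolded br_def] C[unfolded br_def]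
    by (cases i; cases j; cases p; cases q) (simp_all add: psign_def mult_expand algebra_simps)
qed

text \<open>Triple products become words on either side of a product, so no correction term arises:
  supercommutation with the supercommutator of \<open>x\<close> and \<open>y\<close> is a derivation
  on words.\<close>

lemma supertriple_supertriple:
  assumes "x \<in> A i" "y \<in> A j" "u \<in> A p" "v \<in> A q" "w \<in> A r"
  defines "tr \<equiv> supertriple scale A m"
  shows "tr x y (tr u v w) =
        tr (tr x y u) v w
        + psign (p * (i + j)) (tr u (tr x y v) w)
        + psign ((i + j) * (p + q)) (tr u v (tr x y w))"
proof -
  note g = supertriple_graded
  note T = mult_supertriple
  note outer =
    supertriple_words[OF assms(1,2) g[OF assms(3,4,5)]]
    supertriple_words[OF g[OF assms(1,2,3)] assms(4,5)]
    supertriple_words[OF assms(3) g[OF assms(1,2,4)] assms(5)]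
    supertriple_words[OF assms(3,4) g[OF assms(1,2,5)]]
  \<comment> \<open>In \<open>outer\<close> a triple product is a right factor only after one letter
    or after a product of two; these instances cover all such places.\<close>
  note right = T[OF mult_graded[OF assms(1,2)] assms(3,4,5)] T[OF mult_graded[OF assms(2,1)] assms(3,4,5)]
    T[OF assms(4,1,2,3)] T[OF mult_graded[OF assms(5,4)] assms(1,2,3)]
    T[OF mult_graded[OF assms(4,5)] assms(1,2,3)] T[OF assms(5,1,2,3)]
    T[OF assms(3,1,2,4)] T[OF mult_graded[OF assms(5,3)] assms(1,2,4)] T[OF assms(5,1,2,4)]
    T[OF mult_graded[OF assms(3,4)] assms(1,2,5)] T[OF mult_graded[OF assms(4,3)] assms(1,2,5)]
  note inner = supertriple_words[OF assms(3,4,5)]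
    supertriple_words[OF assms(1,2,3)] supertriple_words[OF assms(1,2,4)]
    supertriple_words[OF assms(1,2,5)]
  show ?thesis
    unfolding tr_def outer unfolding right unfolding inner
    by (cases i; cases j; cases p; cases q; cases r)
       (simp_all add: psign_def mult_expand algebra_simps)
qed

lemma bol_superalgebra_supercommutator:
  "bol_superalgebra scale A (supercommutator scale A m) (supertriple scale A m)"
proof unfold_locales
  fix x y z i j k
  assume x: "x \<in> A i" and y: "y \<in> A j"
  show "supercommutator scale A m x y = - psign (i * j) (supercommutator scale A m y x)"
    unfolding supercommutator_homogeneous[OF x y] supercommutator_homogeneous[OF y x]
    by (cases i; cases j) (simp_all add: psign_def mult_expand)
  assume z: "z \<in> A k"
  show "supertriple scale A m x y z = - psign (i * j) (supertriple scale A m y x z)"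
    unfolding supertriple_words[OF x y z] supertriple_words[OF y x z]
    by (cases i; cases j; cases k) (simp_all add: psign_def mult_expand algebra_simps)
  \<comment> \<open>This is the super Jacobi identity in words: each of the six orderings occurs
    twice with opposite signs.\<close>
  show "supertriple scale A m x y z + psign (i * (j + k)) (supertriple scale A m y z x)
      + psign (k * (i + j)) (supertriple scale A m z x y) = 0"
    unfolding supertriple_words[OF x y z] supertriple_words[OF y z x] supertriple_words[OF z x y]
    by (cases i; cases j; cases k) (simp_all add: psign_def mult_expand algebra_simps)
qed (fact bilinear_supercommutator trilinear_supertriple supercommutator_graded
  supertriple_graded supertriple_supercommutator supertriple_supertriple)+

end

theorem theorem3p1:
  fixes scale :: "'k::field \<Rightarrow> 'a::ab_group_add \<Rightarrow> 'a"
    and A :: "bit \<Rightarrow> 'a set"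
    and m :: "'a \<Rightarrow> 'a \<Rightarrow> 'a"
  assumes "CHAR('k) \<noteq> 2" and "CHAR('k) \<noteq> 3"
    and "right_alternative_superalgebra scale A m"
  shows "bol_superalgebra scale A (supercommutator scale A m) (supertriple scale A m)"
  using assms(3) by (rule right_alternative_superalgebra.bol_superalgebra_supercommutator)

end
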